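(* Let $(x,y,k)$ be a good triplet. Then there exist $p,q \in \mathbb{N}$ with $p < x^{2/3}+1$ and $q < x^{1/6}$ such that \begin{itemize} \item $0 < C(q,p,x,y) < 3q x^{1/6} + 1$, \item $|F(q,p,x,y)| < 8q + 1$, \item $|H(q,p,x,y)| < 72 q^4 + 1$. \end{itemize}
   Context: Here $\mathbb{N}=\{1,2,3,\dots\}$. A triple $(x,y,k)$ is a good triplet if $x,y \in \mathbb{N}$, $k = x^3 - y^2 \in \mathbb{Z}$, and $0 < |k| < \sqrt{x}$. The polynomials are defined by $B(q,p,x) = p^2 - q^2x$, $C(q,p,x,y) = p^3 - 3pq^2x + 2q^3y$, $F(q,p,x,y) = 4pC - 3B^2$, and $H(q,p,x,y) = 9FB - 8C^2$, where $B$ and $C$ denote $B(q,p,x)$ and $C(q,p,x,y)$. *)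

theory Defs
  imports Complex_Main
begin

text \<open>The positive integers are the elements of type \<^typ>\<open>nat\<close> that are \<open>\<ge> 1\<close>.\<close>

definition good_triplet :: "nat \<Rightarrow> nat \<Rightarrow> int \<Rightarrow> bool" where
  "good_triplet x y k \<longleftrightarrow>
     x \<ge> 1 \<and> y \<ge> 1 \<and> k = int x ^ 3 - int y ^ 2 \<and>
     0 < \<bar>k\<bar> \<and> real_of_int \<bar>k\<bar> < sqrt (real x)"

definition poly_B :: "int \<Rightarrow> int \<Rightarrow> int \<Rightarrow> int" where
  "poly_B q p x = p ^ 2 - q ^ 2 * x"

definition poly_C :: "int \<Rightarrow> int \<Rightarrow> int \<Rightarrow> int \<Rightarrow> int" where
  "poly_C q p x y = p ^ 3 - 3 * p * q ^ 2 * x + 2 * q ^ 3 * y"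

definition poly_F :: "int \<Rightarrow> int \<Rightarrow> int \<Rightarrow> int \<Rightarrow> int" where
  "poly_F q p x y = 4 * p * poly_C q p x y - 3 * (poly_B q p x) ^ 2"

definition poly_H :: "int \<Rightarrow> int \<Rightarrow> int \<Rightarrow> int \<Rightarrow> int" where
  "poly_H q p x y = 9 * poly_F q p x y * poly_B q p x - 8 * (poly_C q p x y) ^ 2"

end

theory Submission
  imports Defs
begin

text \<open>
  Put \<open>t = x powr (1/6)\<close>, so \<open>sqrt x = t\<^sup>3\<close>, and write \<open>y = t ^ 9 + e\<close>; since
  \<open>y\<^sup>2 = x\<^sup>3 - k\<close> with \<open>\<bar>k\<bar> < t\<^sup>3\<close>, the defect \<open>\<bar>e\<bar>\<close> is about \<open>t powr (-6) / 2\<close> at most.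
  Dirichlet's theorem gives \<open>1 \<le> q < t\<close> and \<open>p = q t\<^sup>3 + d\<close> with \<open>\<bar>d\<bar> \<le> 1 / \<lceil>t\<rceil>\<close>.
  In terms of \<open>q\<close>, \<open>d\<close> and \<open>e\<close> the leading terms of \<open>F\<close> and \<open>H\<close> cancel, and the remaining ones
  are estimated termwise. If \<open>C\<close> vanished, \<open>p/q\<close> would be an integral root \<open>r\<close> of
  \<open>r\<^sup>3 - 3 x r + 2 y\<close> so close to \<open>sqrt x\<close> that \<open>r\<^sup>2 = x\<close>, whence \<open>k = 0\<close>. The estimates need
  \<open>t \<ge> 2\<close>; the only good triplet with \<open>x < 64\<close> is \<open>(2, 3, -1)\<close>.
\<close>

section \<open>Rational approximation with denominator at most N\<close>

text \<open>Compared with \<open>Dirichlet_approx\<close> of HOL-Analysis, the bound is \<open>1 / (N + 1)\<close> instead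
  of \<open>1 / N\<close>; the estimate for \<open>H\<close> needs this.\<close>

lemma Dirichlet_approx_Suc:
  fixes \<theta> :: real and N :: nat
  assumes "N \<ge> 1"
  obtains q :: nat and p :: int
  where "1 \<le> q" "q \<le> N" "\<bar>of_int p - of_nat q * \<theta>\<bar> \<le> 1 / (real N + 1)"
proof (cases "\<exists>j\<in>{1..N}. frac (real j * \<theta>) \<ge> N / (real N + 1)")
  case True
  \<comment> \<open>Here \<open>j * \<theta>\<close> lies at most \<open>1 / (N + 1)\<close> below
    the next integer, so \<open>q = j\<close> and that integer already serve.\<close>
  then obtain j where j: "j \<in> {1..N}" "frac (real j * \<theta>) \<ge> N / (real N + 1)" by blast
  have "1 - N / (real N + 1) = 1 / (real N + 1)" by (simp add: field_simps)
  then have "\<bar>of_int (\<lfloor>real j * \<theta>\<rfloor> + 1) - real j * \<theta>\<bar> \<le> 1 / (real N + 1)"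
    using j frac_lt_1[of "real j * \<theta>"] by (simp add: frac_def)
  then show ?thesis using that[of j "\<lfloor>real j * \<theta>\<rfloor> + 1"] j by auto
next
  case False
  \<comment> \<open>\<open>b j\<close> is the index of the box of width \<open>1 / (N + 1)\<close>
    containing the fractional part. The case assumption empties the last of the \<open>N + 1\<close>
    boxes, so the \<open>N + 1\<close> indices \<open>0..N\<close> share only \<open>N\<close>
    boxes; two in the same box give \<open>q = j - i\<close>.\<close>
  define b where "b j = nat \<lfloor>frac (real j * \<theta>) * (real N + 1)\<rfloor>" for j :: nat
  have b_real: "real (b j) = of_int \<lfloor>frac (real j * \<theta>) * (real N + 1)\<rfloor>" for j
    by (simp add: b_def)
  have "b j < N" if "j \<in> {0..N}" for j
  proof (cases "j = 0")
    case True
    then show ?thesis using assms by (simp add: b_def)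
  next
    case nz: False
    then have "j \<in> {1..N}" using that by auto
    then have "frac (real j * \<theta>) < N / (real N + 1)" using False by (meson not_le)
    then have "frac (real j * \<theta>) * (real N + 1) < N" by (simp add: field_simps)
    then have "real (b j) < real N" unfolding b_real by linarith
    then show ?thesis by simp
  qed
  then have "b ` {0..N} \<subseteq> {..<N}" by auto
  then have "card (b ` {0..N}) < card {0..N}"
    using card_mono[of "{..<N}" "b ` {0..N}"] by simp
  then have "\<not> inj_on b {0..N}" by (rule pigeonhole)
  then obtain i j where ij: "i \<in> {0..N}" "j \<in> {0..N}" "i < j" "b i = b j"
    unfolding inj_on_def by (metis linorder_neqE_nat)
  let ?f = "\<lambda>n. frac (real n * \<theta>)"
  have "\<bar>?f j * (real N + 1) - ?f i * (real N + 1)\<bar> < 1"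
    using b_real[of i] b_real[of j] ij(4) by linarith
  then have "\<bar>?f j - ?f i\<bar> * (real N + 1) < 1"
    by (metis abs_mult abs_of_nonneg left_diff_distrib of_nat_0_le_iff add_nonneg_nonneg zero_le_one)
  then have *: "\<bar>?f j - ?f i\<bar> \<le> 1 / (real N + 1)" by (simp add: field_simps)
  have "of_int (\<lfloor>real j * \<theta>\<rfloor> - \<lfloor>real i * \<theta>\<rfloor>) - real (j - i) * \<theta> = - (?f j - ?f i)"
    using ij(3) by (simp add: frac_def of_nat_diff algebra_simps)
  then have "\<bar>of_int (\<lfloor>real j * \<theta>\<rfloor> - \<lfloor>real i * \<theta>\<rfloor>) - real (j - i) * \<theta>\<bar> \<le> 1 / (real N + 1)"
    using * by linarith
  then show ?thesis
    using that[of "j - i" "\<lfloor>real j * \<theta>\<rfloor> - \<lfloor>real i * \<theta>\<rfloor>"] ij by auto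
qed

section \<open>C, F and H expanded around p = q sqrt x\<close>

text \<open>For \<open>e = 0\<close> the polynomial C has the double root \<open>p = q * s\<close>
  and factors as \<open>(p - q * s) ^ 2 * (p + 2 * q * s)\<close>; the defect \<open>e\<close> adds
  only \<open>2 * q ^ 3 * e\<close>.\<close>

lemma poly_C_expansion:
  fixes p q x y :: int and s d e :: real
  assumes "of_int p = q * s + d" "of_int x = s ^ 2" "of_int y = s ^ 3 + e"
  shows "of_int (poly_C q p x y) = d ^ 2 * (3 * q * s + d) + 2 * q ^ 3 * e"
  by (simp add: poly_C_def assms) algebra

text \<open>With \<open>B = d * (2 * q * s + d)\<close>, the terms
  \<open>12 * q ^ 2 * s ^ 2 * d ^ 2\<close> of \<open>4 * p * C\<close> and \<open>3 * B ^ 2\<close>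
  cancel, which gains a factor of order \<open>d / (q * s)\<close>.\<close>

lemma poly_F_expansion:
  fixes p q x y :: int and s d e :: real
  assumes "of_int p = q * s + d" "of_int x = s ^ 2" "of_int y = s ^ 3 + e"
  shows "of_int (poly_F q p x y) = 4 * q * s * d ^ 3 + d ^ 4 + 8 * q ^ 4 * s * e + 8 * q ^ 3 * d * e"
  by (simp add: poly_F_def poly_B_def assms poly_C_expansion[OF assms]) algebra

text \<open>The weights 9 and 8 make the terms \<open>72 * q ^ 2 * s ^ 2 * d ^ 4\<close> of
  \<open>9 * F * B\<close> and \<open>8 * C ^ 2\<close> cancel.\<close>

lemma poly_H_expansion:
  fixes p q x y :: int and s d e :: real
  assumes "of_int p = q * s + d" "of_int x = s ^ 2" "of_int y = s ^ 3 + e"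
  shows "of_int (poly_H q p x y) = 6 * q * s * d ^ 5 + d ^ 6 + 144 * q ^ 5 * s ^ 2 * e * d
           + 120 * q ^ 4 * s * e * d ^ 2 + 40 * q ^ 3 * e * d ^ 3 - 32 * q ^ 6 * e ^ 2"
  by (simp add: poly_H_def poly_B_def assms poly_C_expansion[OF assms]
      poly_F_expansion[OF assms]) algebra

section \<open>Distance from y to the square root of the cube of x\<close>

text \<open>The factorisation \<open>k = - e * (y + s ^ 3)\<close> is used twice:
  \<open>y + s ^ 3 \<ge> s ^ 3\<close> gives \<open>\<bar>e\<bar> < 1\<close>, and then
  \<open>y + s ^ 3 \<ge> 2 * s ^ 3 - 1\<close> gives the leading constant 1/2, on which the main
  terms of F and H depend.\<close>

lemma sqrt_defect_bound:
  fixes s e y k :: real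
  assumes "s \<ge> 8" "y \<ge> 0" "y = s ^ 3 + e" "k = s ^ 6 - y ^ 2" "\<bar>k\<bar> < s"
  shows "\<bar>e\<bar> * s ^ 2 \<le> 1 / 2 + 1 / (3 * s ^ 3)"
proof -
  have s3: "s ^ 3 \<ge> 512" using power_mono[OF assms(1), of 3] by simp
  have "k = - e * (y + s ^ 3)" using assms(3,4) by algebra
  then have k: "\<bar>e\<bar> * (y + s ^ 3) < s" using assms s3 by (simp add: abs_mult)
  have "\<bar>e\<bar> * s ^ 3 \<le> \<bar>e\<bar> * (y + s ^ 3)" using assms(2) by (intro mult_left_mono) auto
  then have "\<bar>e\<bar> * s ^ 3 < s" using k by simp
  then have "(\<bar>e\<bar> * s ^ 2) * s < 1 * s" by (simp add: power2_eq_square power3_eq_cube mult.assoc)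
  then have "\<bar>e\<bar> * s ^ 2 < 1" using assms(1) mult_less_cancel_right_pos[of s] by simp
  moreover have "\<bar>e\<bar> * 1 \<le> \<bar>e\<bar> * s ^ 2" using assms(1) by (intro mult_left_mono) auto
  ultimately have "2 * s ^ 3 - 1 \<le> y + s ^ 3" using assms(3) by linarith
  then have "\<bar>e\<bar> * (2 * s ^ 3 - 1) \<le> \<bar>e\<bar> * (y + s ^ 3)" by (intro mult_left_mono) auto
  then have "\<bar>e\<bar> * (2 * s ^ 3 - 1) < s" using k by linarith
  then have "\<bar>e\<bar> * (2 * s ^ 3 - 1) * s ^ 2 \<le> s * s ^ 2" by (intro mult_right_mono) auto
  then have "\<bar>e\<bar> * s ^ 2 * (2 * s ^ 3 - 1) \<le> s ^ 3"
    by (simp add: power3_eq_cube power2_eq_square mult_ac)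
  then have "\<bar>e\<bar> * s ^ 2 \<le> s ^ 3 / (2 * s ^ 3 - 1)" using s3 by (simp add: pos_le_divide_eq)
  also have "\<dots> = 1 / 2 + 1 / (4 * s ^ 3 - 2)"
  proof -
    have "2 * s ^ 3 - 1 \<noteq> 0" "4 * s ^ 3 - 2 \<noteq> 0" using s3 by auto
    then show ?thesis by (simp add: divide_simps)
  qed
  also have "\<dots> \<le> 1 / 2 + 1 / (3 * s ^ 3)"
    using s3 assms(1) by (intro add_left_mono divide_left_mono mult_pos_pos) auto
  finally show ?thesis .
qed

section \<open>Termwise estimates for C, F and H\<close>

context
  fixes t q d e :: real
  assumes t: "t \<ge> 2" and q: "1 \<le> q" "q < t"
    and d: "\<bar>d\<bar> \<le> 1 / t" "\<bar>d\<bar> \<le> 1 / (q + 1)"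
    and e: "\<bar>e\<bar> * t ^ 6 \<le> 1 / 2 + 1 / (3 * t ^ 9)"
begin

lemma td_le: "t * \<bar>d\<bar> \<le> 1"
  using d(1) t by (simp add: field_simps)

lemma tpow_dpow_le: "t ^ n * \<bar>d\<bar> ^ n \<le> 1"
  using td_le t by (simp flip: power_mult_distrib add: power_le_one)

lemma d_le_half: "\<bar>d\<bar> \<le> 1 / 2"
proof -
  have "1 / t \<le> 1 / 2" using t by (simp add: field_simps)
  then show ?thesis using d(1) by linarith
qed

lemma dpow_le: "\<bar>d\<bar> ^ n \<le> (1 / 2) ^ n"
  using d_le_half by (intro power_mono) auto

lemma tpow_ge: "t ^ n \<ge> 2 ^ n"
  using t by (intro power_mono) auto

text \<open>At \<open>t = 2\<close> the assumed bound is \<open>1 / 2 + 1 / 1536\<close>. The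
  rounded constant suffices for the minor terms; a further factor \<open>t ^ 3 \<ge> 8\<close> turns
  it into \<open>51 / 800\<close>.\<close>

lemma et6_le: "\<bar>e\<bar> * t ^ 6 \<le> 51 / 100"
proof -
  have "1 / (3 * t ^ 9) \<le> 1 / (3 * 512)" using tpow_ge[of 9] t by (intro divide_left_mono) auto
  then show ?thesis using e by simp
qed

lemma et3_le: "\<bar>e\<bar> * t ^ 3 \<le> 51 / 800"
proof -
  have "\<bar>e\<bar> * t ^ 3 * 8 \<le> \<bar>e\<bar> * t ^ 3 * t ^ 3"
    using tpow_ge[of 3] t by (intro mult_left_mono) auto
  also have "\<dots> = \<bar>e\<bar> * t ^ 6" by (simp flip: power_add add: mult.assoc)
  finally show ?thesis using et6_le by simp
qed

lemma qpow_le: "q ^ n \<le> t ^ n"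
  using q by (intro power_mono) auto

lemma q3e_le: "q ^ 3 * \<bar>e\<bar> \<le> 51 / 800"
proof -
  have "q ^ 3 * \<bar>e\<bar> \<le> t ^ 3 * \<bar>e\<bar>" using qpow_le by (intro mult_right_mono) auto
  then show ?thesis using et3_le by (simp add: mult.commute)
qed

text \<open>The dominant term \<open>3 * q * t ^ 3 * d ^ 2\<close> is nonnegative and, by
  \<open>t * \<bar>d\<bar> \<le> 1\<close>, at most \<open>3 * q * t\<close>. The rest is
  \<open>d ^ 3 + 2 * q ^ 3 * e\<close>, at most \<open>1 / 8 + 51 / 400\<close> in absolute
  value.\<close>

lemma C_estimate:
  "\<bar>d ^ 2 * (3 * q * t ^ 3 + d) + 2 * q ^ 3 * e - 3 * q * t ^ 3 * d ^ 2\<bar> < 1"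
  "3 * q * t ^ 3 * d ^ 2 \<le> 3 * q * t"
  "d ^ 2 * (3 * q * t ^ 3 + d) + 2 * q ^ 3 * e > - 1"
proof -
  have d3: "\<bar>d ^ 3\<bar> \<le> 1 / 8" using dpow_le[of 3] by (simp add: power_abs power_divide)
  have e3: "\<bar>2 * q ^ 3 * e\<bar> \<le> 2 * (51 / 800)" using q3e_le q by (simp add: abs_mult)
  have eq: "d ^ 2 * (3 * q * t ^ 3 + d) + 2 * q ^ 3 * e
      = 3 * q * t ^ 3 * d ^ 2 + d ^ 3 + 2 * q ^ 3 * e" by algebra
  show "\<bar>d ^ 2 * (3 * q * t ^ 3 + d) + 2 * q ^ 3 * e - 3 * q * t ^ 3 * d ^ 2\<bar> < 1"
    unfolding eq using d3 e3 by linarith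
  have "3 * q * t * (t ^ 2 * d ^ 2) \<le> 3 * q * t * 1"
    using tpow_dpow_le[of 2] q t by (intro mult_left_mono) auto
  then show "3 * q * t ^ 3 * d ^ 2 \<le> 3 * q * t"
    by (simp add: power2_eq_square power3_eq_cube mult_ac)
  have "0 \<le> 3 * q * t ^ 3 * d ^ 2" using q t by simp
  then show "d ^ 2 * (3 * q * t ^ 3 + d) + 2 * q ^ 3 * e > - 1"
    unfolding eq using d3 e3 by linarith
qed

text \<open>Each of the terms in \<open>q * t ^ 3 * d ^ 3\<close> and
  \<open>q ^ 4 * t ^ 3 * e\<close> contributes \<open>4 * q\<close>, the second by
  \<open>q \<le> t\<close> and the sharp bound on \<open>e\<close> with an excess of at most
  \<open>1 / 96\<close>. This excess and the two other terms stay below 1.\<close>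

lemma F_estimate:
  "\<bar>4 * q * t ^ 3 * d ^ 3 + d ^ 4 + 8 * q ^ 4 * t ^ 3 * e + 8 * q ^ 3 * d * e\<bar> < 8 * q + 1"
proof -
  have "4 * q * (t ^ 3 * \<bar>d\<bar> ^ 3) \<le> 4 * q * 1"
    using tpow_dpow_le[of 3] q by (intro mult_left_mono) auto
  then have 1: "\<bar>4 * q * t ^ 3 * d ^ 3\<bar> \<le> 4 * q" using q t by (simp add: abs_mult power_abs mult.assoc)
  have 2: "\<bar>d ^ 4\<bar> \<le> 1 / 16" using dpow_le[of 4] by (simp add: power_abs power_divide)
  have "8 * q ^ 4 * t ^ 3 * \<bar>e\<bar> = 8 * q * (q ^ 3 * (t ^ 3 * \<bar>e\<bar>))" by algebra
  also have "\<dots> \<le> 8 * q * (t ^ 3 * (t ^ 3 * \<bar>e\<bar>))"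
    using qpow_le[of 3] q t by (intro mult_left_mono mult_right_mono) auto
  also have "\<dots> = 8 * q * (\<bar>e\<bar> * t ^ 6)" by algebra
  also have "\<dots> \<le> 8 * q * (1 / 2 + 1 / (3 * t ^ 9))"
    using e q by (intro mult_left_mono) auto
  also have "\<dots> = 4 * q + 8 / 3 * (q / t ^ 9)" by (simp add: field_simps)
  also have "q / t ^ 9 \<le> t / t ^ 9" using q t by (intro divide_right_mono) auto
  also have "t / t ^ 9 = 1 / t ^ 8" using t by (simp add: field_simps flip: power_Suc)
  also have "1 / t ^ 8 \<le> 1 / 256" using tpow_ge[of 8] t by (intro divide_left_mono) auto
  finally have "8 * q ^ 4 * t ^ 3 * \<bar>e\<bar> \<le> 4 * q + 8 / 3 * (1 / 256)" by simp
  then have 3: "\<bar>8 * q ^ 4 * t ^ 3 * e\<bar> \<le> 4 * q + 1 / 96" using q t by (simp add: abs_mult)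
  have "q ^ 3 * \<bar>e\<bar> * \<bar>d\<bar> \<le> 51 / 800 * (1 / 2)"
    using q3e_le d_le_half q by (intro mult_mono) auto
  then have 4: "\<bar>8 * q ^ 3 * d * e\<bar> \<le> 8 * (51 / 800 * (1 / 2))" using q by (simp add: abs_mult mult_ac)
  show ?thesis using 1 2 3 4 by linarith
qed

text \<open>The main term is \<open>144 * q ^ 5 * t ^ 6 * e * d\<close>. Here
  \<open>\<bar>d\<bar> \<le> 1 / (q + 1)\<close> matters: it saves
  \<open>72 * q ^ 4 / (q + 1) \<ge> 36\<close> against \<open>72 * q ^ 4\<close>, of which
  \<open>69 / 2\<close> remains after the error \<open>3 / 2\<close> from \<open>e\<close>. The
  saving pays for all other terms, the largest being at most \<open>153 / 5\<close>.\<close>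

lemma H_estimate:
  "\<bar>6 * q * t ^ 3 * d ^ 5 + d ^ 6 + 144 * q ^ 5 * (t ^ 3) ^ 2 * e * d
     + 120 * q ^ 4 * t ^ 3 * e * d ^ 2 + 40 * q ^ 3 * e * d ^ 3 - 32 * q ^ 6 * e ^ 2\<bar>
   < 72 * q ^ 4 + 1"
proof -
  have "6 * q * t ^ 3 * \<bar>d\<bar> ^ 5 \<le> 6 * t * t ^ 3 * \<bar>d\<bar> ^ 5"
    using q t by (intro mult_right_mono) auto
  also have "\<dots> = 6 * (t ^ 4 * \<bar>d\<bar> ^ 4) * \<bar>d\<bar>" by algebra
  also have "\<dots> \<le> 6 * 1 * (1 / 2)"
    using tpow_dpow_le[of 4] d_le_half t by (intro mult_mono) auto
  finally have 1: "\<bar>6 * q * t ^ 3 * d ^ 5\<bar> \<le> 3" using q t by (simp add: abs_mult power_abs)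
  have 2: "\<bar>d ^ 6\<bar> \<le> 1 / 64" using dpow_le[of 6] by (simp add: power_abs power_divide)
  have "144 * q ^ 5 * (t ^ 3) ^ 2 * \<bar>e\<bar> * \<bar>d\<bar> = 144 * q ^ 5 * ((\<bar>e\<bar> * t ^ 6) * \<bar>d\<bar>)" by algebra
  also have "\<dots> \<le> 144 * q ^ 5 * ((1 / 2 + 1 / (3 * t ^ 9)) * (1 / (q + 1)))"
    using e d(2) q t by (intro mult_left_mono mult_mono) auto
  also have "\<dots> = 72 * (q ^ 5 / (q + 1)) + 48 * (q ^ 4 / t ^ 9) * (q / (q + 1))"
  proof -
    have "q + 1 \<noteq> 0" "t \<noteq> 0" using q t by auto
    then show ?thesis by (simp add: divide_simps) algebra
  qed
  also have "q ^ 5 / (q + 1) = q ^ 4 - q ^ 4 / (q + 1)" using q by (simp add: field_simps) algebra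
  also have "48 * (q ^ 4 / t ^ 9) * (q / (q + 1)) \<le> 48 * (1 / 32) * 1"
  proof -
    have "q ^ 4 / t ^ 9 \<le> t ^ 4 / t ^ 9" using qpow_le t by (intro divide_right_mono) auto
    also have "\<dots> = 1 / t ^ 5" using t by (simp add: field_simps flip: power_add)
    also have "\<dots> \<le> 1 / 32" using tpow_ge[of 5] t by (intro divide_left_mono) auto
    finally show ?thesis using q t by (intro mult_mono) auto
  qed
  finally have 3: "144 * q ^ 5 * (t ^ 3) ^ 2 * \<bar>e\<bar> * \<bar>d\<bar>
      \<le> 72 * q ^ 4 - 72 * (q ^ 4 / (q + 1)) + 3 / 2" by simp
  have "q ^ 4 \<ge> q" using q power_increasing[of 1 4 q] by simp
  then have "q ^ 4 / (q + 1) \<ge> 1 / 2" using q by (simp add: field_simps)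
  with 3 have "144 * q ^ 5 * (t ^ 3) ^ 2 * \<bar>e\<bar> * \<bar>d\<bar> \<le> 72 * q ^ 4 - 69 / 2" by linarith
  then have 3: "\<bar>144 * q ^ 5 * (t ^ 3) ^ 2 * e * d\<bar> \<le> 72 * q ^ 4 - 69 / 2"
    using q t by (simp add: abs_mult)
  have "120 * q ^ 4 * t ^ 3 * \<bar>e\<bar> * \<bar>d\<bar> ^ 2 \<le> 120 * t ^ 4 * t ^ 3 * \<bar>e\<bar> * \<bar>d\<bar> ^ 2"
    using qpow_le[of 4] t by (intro mult_right_mono) auto
  also have "\<dots> = 120 * (\<bar>e\<bar> * t ^ 6) * ((t * \<bar>d\<bar>) * \<bar>d\<bar>)" by algebra
  also have "\<dots> \<le> 120 * (51 / 100) * (1 * (1 / 2))"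
    using et6_le td_le d_le_half t by (intro mult_mono) auto
  finally have 4: "\<bar>120 * q ^ 4 * t ^ 3 * e * d ^ 2\<bar> \<le> 153 / 5"
    using q t by (simp add: abs_mult power_abs)
  have "q ^ 3 * \<bar>e\<bar> * \<bar>d\<bar> ^ 3 \<le> 51 / 800 * (1 / 2) ^ 3"
    using q3e_le dpow_le[of 3] q by (intro mult_mono) auto
  then have 5: "\<bar>40 * q ^ 3 * e * d ^ 3\<bar> \<le> 51 / 160"
    using q by (simp add: abs_mult power_abs power_divide)
  have "(q ^ 3 * \<bar>e\<bar>) ^ 2 \<le> (51 / 800) ^ 2" using q3e_le q by (intro power_mono) auto
  then have 6: "\<bar>32 * q ^ 6 * e ^ 2\<bar> \<le> 32 * (51 / 800) ^ 2"
    by (simp add: abs_mult power_mult_distrib flip: power_mult)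
  have "(51 / 800) ^ 2 \<le> (1 / 200 :: real)" by (simp add: power2_eq_square)
  with 1 2 3 4 5 6 show ?thesis by linarith
qed

end

section \<open>Nonvanishing of C\<close>

text \<open>This is the rational root theorem: \<open>p / q\<close> is a root of the monic
  polynomial \<open>X ^ 3 - 3 * x * X + 2 * y\<close>, hence an integer. In lowest terms the
  denominator divides the cube of the numerator, so it is a unit.\<close>

lemma poly_C_zero_imp_dvd:
  fixes p q x y :: int
  assumes "q \<noteq> 0" "poly_C q p x y = 0"
  shows "q dvd p"
proof -
  obtain g p' q' where g: "p = p' * g" "q = q' * g" "coprime p' q'" "g \<noteq> 0"
    using gcd_coprime_exists[of p q] assms(1) by auto
  have "g ^ 3 * (p' ^ 3 - 3 * p' * q' ^ 2 * x + 2 * q' ^ 3 * y) = 0"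
    using assms(2) unfolding poly_C_def g by algebra
  then have "p' ^ 3 = q' * (3 * p' * q' * x - 2 * q' ^ 2 * y)" using g(4) by simp algebra
  then have dvd: "q' dvd p' ^ 3" by simp
  have "coprime q' (p' ^ 3)" using g(3) by (simp add: coprime_commute)
  then have "is_unit q'" by (rule coprime_common_divisor[OF _ dvd_refl dvd])
  then have "q' dvd p'" by (rule unit_imp_dvd)
  then show ?thesis using g by simp
qed

lemma poly_C_nonzero:
  fixes p q x y :: int and s e :: real
  assumes "q \<ge> 1" "p \<ge> 0" "s \<ge> 8" "of_int x = s ^ 2" "of_int y = s ^ 3 + e"
    and d: "\<bar>of_int p - q * s\<bar> \<le> 1"
    and e: "\<bar>e\<bar> * s ^ 2 \<le> 1" and k: "x ^ 3 \<noteq> y ^ 2"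
  shows "poly_C q p x y \<noteq> 0"
proof
  assume C0: "poly_C q p x y = 0"
  then obtain r where r: "p = q * r" using poly_C_zero_imp_dvd assms(1) by (metis dvdE not_one_le_zero)
  have r0: "r \<ge> 0" using assms(1,2) r by (simp add: zero_le_mult_iff)
  have "q ^ 3 * (r ^ 3 - 3 * r * x + 2 * y) = 0" using C0 unfolding poly_C_def r by algebra
  then have root: "r ^ 3 - 3 * r * x + 2 * y = 0" using assms(1) by simp
  have "1 * \<bar>of_int r - s\<bar> \<le> q * \<bar>of_int r - s\<bar>" using assms(1) by (intro mult_right_mono) auto
  also have "\<dots> = \<bar>of_int p - q * s\<bar>" using assms(1) by (simp add: r abs_mult flip: right_diff_distrib)
  also have "\<dots> \<le> 1" by (rule d)
  finally have rs: "of_int r \<le> s + 1" by (simp add: abs_le_iff)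
  have "(of_int r - s) ^ 2 * (of_int r + 2 * s) = of_int (r ^ 3 - 3 * r * x + 2 * y) - 2 * e"
    by (simp add: assms(4,5)) algebra
  then have eq: "(of_int r - s) ^ 2 * (of_int r + 2 * s) = - 2 * e" using root by simp
  \<comment> \<open>Multiplying by \<open>(r + s) ^ 2\<close> replaces \<open>r - s\<close> by the
    integer \<open>r ^ 2 - x\<close>. One factor \<open>r + s\<close> is enlarged to
    \<open>r + 2 * s\<close> to reach the tiny quantity \<open>- 2 * e\<close>; an integer square
    below 1 is then 0.\<close>
  have "(of_int (r ^ 2 - x) :: real) ^ 2 = (of_int r - s) ^ 2 * (of_int r + s) * (of_int r + s)"
    by (simp add: assms(4)) algebra
  also have "\<dots> \<le> (of_int r - s) ^ 2 * (of_int r + 2 * s) * (of_int r + s)"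
    using r0 assms(3) by (intro mult_right_mono mult_left_mono) auto
  also have "\<dots> \<le> 2 * \<bar>e\<bar> * (of_int r + s)"
    unfolding eq using r0 assms(3) by (intro mult_right_mono) auto
  also have "\<dots> \<le> 2 * \<bar>e\<bar> * (2 * s + 1)" using rs by (intro mult_left_mono) auto
  also have "\<dots> < 1"
  proof -
    have "s ^ 2 \<ge> 8 * s" using assms(3) by (simp add: power2_eq_square)
    then have "4 * s + 2 < s ^ 2" using assms(3) by linarith
    then have "\<bar>e\<bar> * (4 * s + 2) < \<bar>e\<bar> * s ^ 2" if "e \<noteq> 0"
      using that by (intro mult_strict_left_mono) auto
    then show ?thesis using e by (cases "e = 0") (auto simp: algebra_simps)
  qed
  finally have "real_of_int ((r ^ 2 - x) ^ 2) < 1" by simp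
  then have "(r ^ 2 - x) ^ 2 < 1" by linarith
  then have rx: "x = r ^ 2" using zero_less_power2[of "r ^ 2 - x"] by linarith
  then have "y = r ^ 3" using root by (simp add: power2_eq_square power3_eq_cube)
  then show False using k rx by (simp flip: power_mult)
qed

section \<open>Good triplets with x below 64\<close>

text \<open>The second list contains the integer square roots of \<open>x ^ 3\<close>. Only the three squares
  nearest to \<open>x ^ 3\<close> have to be inspected.\<close>

lemma small_cubes_far_from_squares:
  "list_all2 (\<lambda>x m :: nat. m ^ 2 \<le> x ^ 3 \<and> x ^ 3 < (m + 1) ^ 2 \<and>
       x \<le> (x ^ 3 - (m - 1) ^ 2) ^ 2 \<and> (x ^ 3 = m ^ 2 \<or> x \<le> (x ^ 3 - m ^ 2) ^ 2) \<and>
       x \<le> ((m + 1) ^ 2 - x ^ 3) ^ 2)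
     [3..<64]
     [5, 8, 11, 14, 18, 22, 27, 31, 36, 41, 46, 52, 58, 64, 70, 76, 82, 89, 96, 103,
      110, 117, 125, 132, 140, 148, 156, 164, 172, 181, 189, 198, 207, 216, 225, 234,
      243, 252, 262, 272, 281, 291, 301, 311, 322, 332, 343, 353, 364, 374, 385, 396,
      407, 419, 430, 441, 453, 464, 476, 488, 500]"
  by (simp add: upt_conv_Cons)

lemma list_all2_imp_ex:
  assumes "list_all2 P xs ys" "x \<in> set xs"
  shows "\<exists>y. P x y"
  using assms by (induction rule: list_all2_induct) auto

text \<open>Squaring the bound on \<open>k\<close> gives the integer condition
  \<open>k ^ 2 < x\<close>, which the table refutes for \<open>x \<ge> 3\<close>. For
  \<open>x = 1\<close> it forces \<open>k = 0\<close>; for \<open>x = 2\<close> it leaves only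
  \<open>y ^ 2 = 9\<close>.\<close>

lemma good_triplet_less_64:
  assumes "good_triplet x y k" "x < 64"
  shows "x = 2 \<and> y = 3"
proof -
  have k: "k = int x ^ 3 - int y ^ 2" "k \<noteq> 0" "x \<ge> 1"
    and kx: "real_of_int \<bar>k\<bar> < sqrt (real x)"
    using assms(1) by (auto simp: good_triplet_def)
  have "(real_of_int \<bar>k\<bar>) ^ 2 < real x" using real_less_rsqrt kx
    by (metis abs_ge_zero of_int_0_le_iff of_nat_0_le_iff power_strict_mono pos2 real_sqrt_pow2)
  then have "real_of_int (k ^ 2) < real_of_int (int x)" by simp
  then have k2: "k ^ 2 < int x" by (simp only: of_int_less_iff)
  \<comment> \<open>The table uses truncated subtraction on \<open>nat\<close>, so the condition is
    restated for each sign of \<open>k\<close>.\<close>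
  have diff1: "(x ^ 3 - y ^ 2) ^ 2 < x" if "y ^ 2 \<le> x ^ 3"
  proof -
    have "int ((x ^ 3 - y ^ 2) ^ 2) = k ^ 2" using that by (simp add: of_nat_diff k)
    then show ?thesis using k2 by linarith
  qed
  have diff2: "(y ^ 2 - x ^ 3) ^ 2 < x" if "x ^ 3 \<le> y ^ 2"
  proof -
    have "int ((y ^ 2 - x ^ 3) ^ 2) = k ^ 2" using that by (simp add: of_nat_diff k power2_commute)
    then show ?thesis using k2 by linarith
  qed
  have ne: "x ^ 3 \<noteq> y ^ 2"
  proof
    assume "x ^ 3 = y ^ 2"
    then have "int (x ^ 3) = int (y ^ 2)" by simp
    then show False using k by simp
  qed
  have "x = 1 \<or> x = 2 \<or> 3 \<le> x" using k(3) by linarith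
  then consider "x = 1" | "x = 2" | "x \<in> set [3..<64]"
    using assms(2) unfolding set_upt atLeastLessThan_iff by blast
  then show ?thesis
  proof cases
    case 1
    then have "k ^ 2 < 1" using k2 by simp
    then show ?thesis using zero_less_power2[of k] k(2) by linarith
  next
    case 2
    have "y < 2 \<or> y = 2 \<or> y = 3 \<or> y \<ge> 4" by linarith
    then show ?thesis
    proof (elim disjE)
      assume "y < 2"
      then have "y = 0 \<or> y = 1" by auto
      then show ?thesis using diff1 2 by auto
    next
      assume "y \<ge> 4"
      then have "y ^ 2 \<ge> 16" using power_mono[of 4 y 2] by simp
      then have "(y ^ 2 - 8) ^ 2 < 2" "8 ^ 2 \<le> (y ^ 2 - 8) ^ 2"
        using diff2 2 by simp (intro power_mono, use \<open>y ^ 2 \<ge> 16\<close> in auto)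
      then show ?thesis by simp
    qed (use diff1 2 in auto)
  next
    case 3
    obtain m where m: "m ^ 2 \<le> x ^ 3" "x ^ 3 < (m + 1) ^ 2"
      and check: "x \<le> (x ^ 3 - (m - 1) ^ 2) ^ 2" "x ^ 3 = m ^ 2 \<or> x \<le> (x ^ 3 - m ^ 2) ^ 2"
      "x \<le> ((m + 1) ^ 2 - x ^ 3) ^ 2"
      using list_all2_imp_ex[OF small_cubes_far_from_squares 3] by blast
    \<comment> \<open>Squares beyond \<open>(m - 1) ^ 2\<close> or \<open>(m + 1) ^ 2\<close> are
      even farther from \<open>x ^ 3\<close>, so monotonicity reduces every \<open>y\<close> to a
      tabulated square.\<close>
    have "y \<le> m - 1 \<or> y = m \<or> m + 1 \<le> y" by linarith
    then show ?thesis
    proof (elim disjE)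
      assume "y \<le> m - 1"
      then have le: "y ^ 2 \<le> (m - 1) ^ 2" by (rule power_mono) simp
      have "(m - 1) ^ 2 \<le> m ^ 2" by (rule power_mono) auto
      then have "(x ^ 3 - y ^ 2) ^ 2 < x" using diff1 le m(1) by linarith
      moreover have "(x ^ 3 - (m - 1) ^ 2) ^ 2 \<le> (x ^ 3 - y ^ 2) ^ 2"
        by (intro power_mono diff_le_mono2 le) simp
      ultimately show ?thesis using check(1) by linarith
    next
      assume "y = m"
      then show ?thesis using check(2) ne diff1 m(1) by auto
    next
      assume "m + 1 \<le> y"
      then have le: "(m + 1) ^ 2 \<le> y ^ 2" by (rule power_mono) simp
      then have "(y ^ 2 - x ^ 3) ^ 2 < x" using diff2 m(2) by linarith
      moreover have "((m + 1) ^ 2 - x ^ 3) ^ 2 \<le> (y ^ 2 - x ^ 3) ^ 2"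
        by (intro power_mono diff_le_mono le) simp
      ultimately show ?thesis using check(3) by linarith
    qed
  qed
qed

theorem theorem2p4:
  fixes x y :: nat and k :: int
  assumes "good_triplet x y k"
  shows "\<exists>p q :: nat. p \<ge> 1 \<and> q \<ge> 1 \<and>
    real p < real x powr (2 / 3) + 1 \<and>
    real q < real x powr (1 / 6) \<and>
    0 < poly_C (int q) (int p) (int x) (int y) \<and>
    real_of_int (poly_C (int q) (int p) (int x) (int y)) < 3 * real q * real x powr (1 / 6) + 1 \<and>
    \<bar>poly_F (int q) (int p) (int x) (int y)\<bar> < 8 * int q + 1 \<and>
    \<bar>poly_H (int q) (int p) (int x) (int y)\<bar> < 72 * int q ^ 4 + 1"
proof (cases "x < 64")
  case True
  then have [simp]: "x = 2" "y = 3" using good_triplet_less_64 assms by auto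
  \<comment> \<open>For \<open>(2, 3, -1)\<close> the choice \<open>p = q = 1\<close> works:
    \<open>C = 1\<close>, \<open>F = 1\<close> and \<open>H = -17\<close>.\<close>
  have "(1::real) < 2 powr (1 / 6)" by simp
  then show ?thesis
    by (intro exI[of _ 1]) (simp add: poly_C_def poly_F_def poly_H_def poly_B_def)
next
  case False
  define t where "t = real x powr (1 / 6)"
  have x0: "real x > 0" using False by simp
  have t0: "t > 0" using x0 by (simp add: t_def)
  have x_t: "real x = t ^ 6" using x0 by (simp add: t_def powr_powr flip: powr_realpow)
  have t4: "real x powr (2 / 3) = t ^ 4" using x0 by (simp add: t_def powr_powr flip: powr_realpow)
  have t2: "t \<ge> 2"
  proof (rule ccontr)
    assume "\<not> t \<ge> 2"
    then have "t ^ 6 < 2 ^ 6" using t0 by (intro power_strict_mono) auto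
    then show False using False x_t by simp
  qed
  have t3: "t ^ 3 \<ge> 8" using power_mono[OF t2, of 3] by simp
  have k: "k = int x ^ 3 - int y ^ 2" "k \<noteq> 0"
    and kx: "real_of_int \<bar>k\<bar> < sqrt (real x)"
    using assms by (auto simp: good_triplet_def)
  have "sqrt (real x) = t ^ 3"
    using t0 by (intro real_sqrt_unique) (simp_all add: x_t flip: power_mult)
  with kx have kt: "\<bar>real_of_int k\<bar> < t ^ 3" by simp
  define e where "e = real y - (t ^ 3) ^ 3"
  have y_e: "real y = (t ^ 3) ^ 3 + e" by (simp add: e_def)
  have "real_of_int k = (t ^ 3) ^ 6 - real y ^ 2"
    using k(1) x_t by (simp flip: power_mult)
  then have "\<bar>e\<bar> * (t ^ 3) ^ 2 \<le> 1 / 2 + 1 / (3 * (t ^ 3) ^ 3)"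
    using sqrt_defect_bound[OF t3 _ y_e _ kt] by simp
  then have e: "\<bar>e\<bar> * t ^ 6 \<le> 1 / 2 + 1 / (3 * t ^ 9)" by (simp flip: power_mult)

  \<comment> \<open>\<open>N\<close> is the largest integer strictly below \<open>t\<close>. Hence
    \<open>q \<le> N\<close> gives the strict bound \<open>q < t\<close>, while
    \<open>N + 1 \<ge> t\<close> and \<open>N + 1 \<ge> q + 1\<close> turn the single Dirichlet
    bound into both bounds on \<open>d\<close>.\<close>
  define N where "N = nat \<lceil>t\<rceil> - 1"
  have N: "N \<ge> 1" "real N < t" "t \<le> real N + 1"
    using t2 unfolding N_def by linarith+
  obtain q :: nat and p' :: int where q: "1 \<le> q" "q \<le> N"
    and p': "\<bar>of_int p' - real q * t ^ 3\<bar> \<le> 1 / (real N + 1)"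
    using Dirichlet_approx_Suc[OF N(1)] by blast
  define d where "d = of_int p' - real q * t ^ 3"
  have qr: "1 \<le> real q" "real q < t" using q N by linarith+
  have "1 / (real N + 1) \<le> 1 / t" using N t0 by (intro divide_left_mono) auto
  then have d1: "\<bar>d\<bar> \<le> 1 / t" using p' by (simp add: d_def)
  have "1 / (real N + 1) \<le> 1 / (real q + 1)" using q by (intro divide_left_mono) auto
  then have d2: "\<bar>d\<bar> \<le> 1 / (real q + 1)" using p' by (simp add: d_def)
  have dh: "\<bar>d\<bar> \<le> 1 / 2" by (rule d_le_half[OF t2 qr d1 d2 e])
  have "1 * t ^ 3 \<le> real q * t ^ 3" using qr t0 by (intro mult_right_mono) auto
  then have "real_of_int p' > 0" using t3 dh unfolding d_def by linarith
  then have "p' > 0" by simp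
  then obtain p :: nat where p: "p' = int p" "p \<ge> 1" by (metis zero_less_imp_eq_int Suc_leI One_nat_def)
  have p_d: "real_of_int (int p) = of_int (int q) * t ^ 3 + d" by (simp add: d_def p)
  have x_s: "real_of_int (int x) = (t ^ 3) ^ 2" by (simp add: x_t flip: power_mult)
  have y_s: "real_of_int (int y) = (t ^ 3) ^ 3 + e" by (simp add: y_e)
  note expansions = poly_C_expansion[OF p_d x_s y_s] poly_F_expansion[OF p_d x_s y_s]
    poly_H_expansion[OF p_d x_s y_s]
  note C = C_estimate[OF t2 qr d1 d2 e]
  have "real q * t ^ 3 < t * t ^ 3" using qr t0 by (intro mult_strict_right_mono) auto
  then have p_less: "real p < t ^ 4 + 1"
    using p_d dh by (simp add: power_Suc[symmetric] del: power_Suc)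
  have C_less: "real_of_int (poly_C (int q) (int p) (int x) (int y)) < 3 * real q * t + 1"
    unfolding expansions(1) using C(1,2) by simp
  \<comment> \<open>Integrality upgrades \<open>C > -1\<close> to \<open>C \<ge> 0\<close>;
    positivity then needs only that C does not vanish.\<close>
  have "real_of_int (poly_C (int q) (int p) (int x) (int y)) > - 1"
    unfolding expansions(1) using C(3) by simp
  then have "poly_C (int q) (int p) (int x) (int y) \<ge> 0" by linarith
  moreover have "poly_C (int q) (int p) (int x) (int y) \<noteq> 0"
  proof (rule poly_C_nonzero[OF _ _ t3 x_s y_s])
    show "\<bar>real_of_int (int p) - real_of_int (int q) * t ^ 3\<bar> \<le> 1" using p_d dh by simp
    show "\<bar>e\<bar> * (t ^ 3) ^ 2 \<le> 1"
      using et6_le[OF t2 qr d1 d2 e] by (simp flip: power_mult)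
    show "int x ^ 3 \<noteq> int y ^ 2" using k by simp
  qed (use q in auto)
  ultimately have C_pos: "poly_C (int q) (int p) (int x) (int y) > 0" by simp
  have "real_of_int \<bar>poly_F (int q) (int p) (int x) (int y)\<bar> < real_of_int (8 * int q + 1)"
    using F_estimate[OF t2 qr d1 d2 e] expansions(2) by simp
  then have F: "\<bar>poly_F (int q) (int p) (int x) (int y)\<bar> < 8 * int q + 1"
    by (simp only: of_int_less_iff)
  have "real_of_int \<bar>poly_H (int q) (int p) (int x) (int y)\<bar> < real_of_int (72 * int q ^ 4 + 1)"
    using H_estimate[OF t2 qr d1 d2 e] expansions(3) by simp
  then have H: "\<bar>poly_H (int q) (int p) (int x) (int y)\<bar> < 72 * int q ^ 4 + 1"
    by (simp only: of_int_less_iff)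
  show ?thesis
    using p(2) q(1) p_less qr(2) C_pos C_less F H unfolding t4 t_def[symmetric] by blast
qed

end
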